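(* For any positive integers $n$ and $t$, write $t=(n+1)q+r$ with $q=\lfloor t/(n+1)\rfloor$ and $0\le r\le n$. Then \[\pi_t^*(K_n)=\begin{cases}2t-2q=2nq+2r & \text{if } r<n,\\ 2t-2q-1=2nq+2n-1 & \text{if } r=n.\end{cases}\] In particular, $\pi_t^*(K_n)=2t$ if and only if $t<n$.
   Context: A distribution on a graph $G=(V,E)$ is a function $D:V\to\mathbb{N}$, with size $|D|=\sum_v D(v)$. A pebbling move removes two pebbles from a vertex having at least two pebbles and places one pebble on a neighbor. A distribution $D$ is $t$-solvable if for every vertex $v$, some sequence of pebbling moves starting from $D$ results in a distribution with at least $t$ pebbles on $v$. The optimal $t$-pebbling number $\pi_t^*(G)$ is the minimum size of a $t$-solvable distribution on $G$. $K_n$ is the complete graph on $n$ vertices. *)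

theory Defs
  imports "Graph_Theory.Graph_Theory"
begin

text \<open>
  As in the imported library, a finite simple graph is a symmetric digraph satisfying the
  locale \<^locale>\<open>graph\<close>.  A distribution on such a graph G is a function
  \<open>D :: 'a \<Rightarrow> nat\<close>; only its values on \<open>verts G\<close> matter, since pebbles elsewhere are
  neither counted nor moved.
\<close>

definition dist_size :: "('a, 'b) pre_digraph \<Rightarrow> ('a \<Rightarrow> nat) \<Rightarrow> nat" where
  "dist_size G D = (\<Sum>v\<in>verts G. D v)"

inductive pebbling_move :: "('a, 'b) pre_digraph \<Rightarrow> ('a \<Rightarrow> nat) \<Rightarrow> ('a \<Rightarrow> nat) \<Rightarrow> bool"
  for G :: "('a, 'b) pre_digraph"
where
  move: "u \<rightarrow>\<^bsub>G\<^esub> v \<Longrightarrow> 2 \<le> D u \<Longrightarrow>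
    pebbling_move G D (\<lambda>w. D w - (if w = u then 2 else 0) + (if w = v then 1 else 0))"

definition t_solvable :: "('a, 'b) pre_digraph \<Rightarrow> nat \<Rightarrow> ('a \<Rightarrow> nat) \<Rightarrow> bool" where
  "t_solvable G t D \<longleftrightarrow> (\<forall>v\<in>verts G. \<exists>D'. (pebbling_move G)\<^sup>*\<^sup>* D D' \<and> t \<le> D' v)"

definition optimal_pebbling_number :: "('a, 'b) pre_digraph \<Rightarrow> nat \<Rightarrow> nat" where
  "optimal_pebbling_number G t = (LEAST s. \<exists>D. t_solvable G t D \<and> dist_size G D = s)"

end

theory Submission
  imports Defs
begin

text \<open>
  In \<open>K\<^sub>n\<close> the best way to bring pebbles to \<open>v\<close> is to move them there directly, so \<open>v\<close> can get
  exactly \<open>D v + (\<Sum>u\<noteq>v. \<lfloor>D u / 2\<rfloor>) = S + \<lceil>D v / 2\<rceil>\<close> pebbles, where \<open>S = (\<Sum>u. \<lfloor>D u / 2\<rfloor>)\<close>.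
  If \<open>k\<close> values of \<open>D\<close> are odd, then \<open>D\<close> has size \<open>2 S + k\<close>, and summing the solvability
  conditions \<open>S + \<lceil>D v / 2\<rceil> \<ge> t\<close> over \<open>v\<close> gives \<open>n t \<le> (n + 1) S + k\<close>.  Minimising
  \<open>2 S + k\<close> under this constraint and \<open>k \<ge> 0\<close> yields the lower bound; it is attained by
  \<open>2 q\<close> pebbles everywhere and \<open>2 r\<close> more on one vertex or, if \<open>r = n\<close>, by \<open>2 q + 2\<close> pebbles
  everywhere except for one vertex with \<open>2 q + 1\<close>.
\<close>

text \<open>Encoded as one sum with a weight per vertex, so that a move changes only two
  summands.\<close>

definition direct_reach :: "('a, 'b) pre_digraph \<Rightarrow> ('a \<Rightarrow> nat) \<Rightarrow> 'a \<Rightarrow> nat" where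
  "direct_reach G D v = (\<Sum>u\<in>verts G. if u = v then D u else D u div 2)"

lemma complete_digraph_finite_verts: "K\<^bsub>n\<^esub> G \<Longrightarrow> finite (verts G)"
  unfolding complete_digraph_def
  by (auto simp: graph_def digraph_def fin_digraph_def fin_digraph_axioms_def)

lemma complete_digraph_card_verts: "K\<^bsub>n\<^esub> G \<Longrightarrow> card (verts G) = n"
  by (simp add: complete_digraph_def)

lemma complete_digraph_adj_iff:
  "K\<^bsub>n\<^esub> G \<Longrightarrow> u \<rightarrow>\<^bsub>G\<^esub> v \<longleftrightarrow> u \<in> verts G \<and> v \<in> verts G \<and> u \<noteq> v"
  by (simp add: complete_digraph_def)

text \<open>A move from \<open>u\<close> to \<open>w\<close> costs at least 1 in the summand of
  \<open>u\<close>, which loses a whole pair, and gains at most 1 in that of \<open>w\<close>,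
  whether or not \<open>v\<close> is one of them. So detours never help.\<close>

lemma direct_reach_move_le:
  assumes K: "K\<^bsub>n\<^esub> G" and "pebbling_move G D D'"
  shows "direct_reach G D' v \<le> direct_reach G D v"
  using assms(2)
proof cases
  case (move u w)
  have uw: "u \<in> verts G" "w \<in> verts G" "u \<noteq> w"
    using move(2) complete_digraph_adj_iff[OF K] by auto
  define h where "h E x = (if x = v then E x else E x div 2)" for E :: "'a \<Rightarrow> nat" and x
  have split: "direct_reach G E v = h E u + (h E w + sum (h E) (verts G - {u} - {w}))" for E
  proof -
    have "direct_reach G E v = sum (h E) (verts G)"
      by (simp add: direct_reach_def h_def)
    also have "\<dots> = h E u + sum (h E) (verts G - {u})"
      using uw complete_digraph_finite_verts[OF K] by (simp add: sum.remove)
    also have "sum (h E) (verts G - {u}) = h E w + sum (h E) (verts G - {u} - {w})"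
      using uw complete_digraph_finite_verts[OF K] by (intro sum.remove) auto
    finally show ?thesis .
  qed
  have "h D' u + 1 \<le> h D u"
    using move uw by (auto simp: h_def)
  moreover have "h D' w \<le> h D w + 1"
    using move uw by (auto simp: h_def)
  moreover have "sum (h D') (verts G - {u} - {w}) = sum (h D) (verts G - {u} - {w})"
    using move by (intro sum.cong) (auto simp: h_def)
  ultimately show ?thesis
    unfolding split by linarith
qed

lemma direct_reach_moves_le:
  assumes "K\<^bsub>n\<^esub> G" and "(pebbling_move G)\<^sup>*\<^sup>* D D'"
  shows "direct_reach G D' v \<le> direct_reach G D v"
  using assms(2)
proof induction
  case base
  show ?case by simp
next
  case (step E E')
  show ?case
    using direct_reach_move_le[OF assms(1) step(2), of v] step(3) by linarith
qed

lemma direct_reach_remove: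
  assumes "finite (verts G)" and "v \<in> verts G"
  shows "direct_reach G D v = D v + (\<Sum>u\<in>verts G - {v}. D u div 2)"
  unfolding direct_reach_def using assms by (subst sum.remove[of _ v]) (auto intro!: sum.cong)

lemma direct_reach_ge:
  assumes "finite (verts G)" and "v \<in> verts G"
  shows "D v \<le> direct_reach G D v"
  by (simp add: direct_reach_remove[OF assms])

text \<open>Induction on the number of pairs outside \<open>v\<close>. Moving one pair to
  \<open>v\<close> trades a unit of the sum for a pebble on \<open>v\<close>, so
  \<open>direct_reach\<close> is unchanged; with no pair left it equals \<open>D v\<close>.\<close>

lemma direct_reach_attained:
  assumes K: "K\<^bsub>n\<^esub> G" and v: "v \<in> verts G"
  shows "\<exists>D'. (pebbling_move G)\<^sup>*\<^sup>* D D' \<and> direct_reach G D v \<le> D' v"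
proof -
  note fin = complete_digraph_finite_verts[OF K]
  note split = direct_reach_remove[OF fin v]
  show ?thesis
  proof (induction "\<Sum>u\<in>verts G - {v}. D u div 2" arbitrary: D)
    case 0
    then show ?case
      by (auto simp: split)
  next
    case (Suc m)
    have "(\<Sum>u\<in>verts G - {v}. D u div 2) \<noteq> 0"
      using Suc(2) by simp
    then obtain u where u: "u \<in> verts G" "u \<noteq> v" and "D u div 2 \<noteq> 0"
      by (rule sum.not_neutral_contains_not_neutral) blast
    then have D2: "2 \<le> D u"
      by simp
    define E where "E = (\<lambda>w. D w - (if w = u then 2 else 0) + (if w = v then 1 else 0))"
    have step: "pebbling_move G D E"
      unfolding E_def using u v D2 by (intro pebbling_move.move) (simp_all add: complete_digraph_adj_iff[OF K])
    have fin': "finite (verts G - {v})" and u': "u \<in> verts G - {v}"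
      using fin u by auto
    have "(\<Sum>x\<in>verts G - {v} - {u}. E x div 2) = (\<Sum>x\<in>verts G - {v} - {u}. D x div 2)"
      by (intro sum.cong) (auto simp: E_def)
    moreover have "E u div 2 + 1 = D u div 2"
      using D2 u by (simp add: E_def)
    ultimately have sumE: "Suc (\<Sum>x\<in>verts G - {v}. E x div 2) = (\<Sum>x\<in>verts G - {v}. D x div 2)"
      using sum.remove[OF fin' u', of "\<lambda>x. E x div 2"] sum.remove[OF fin' u', of "\<lambda>x. D x div 2"]
      by simp
    obtain D' where D': "(pebbling_move G)\<^sup>*\<^sup>* E D'" "direct_reach G E v \<le> D' v"
      using Suc(1)[of E] Suc(2) sumE by auto
    have "E v = D v + 1"
      using u by (simp add: E_def)
    then have "direct_reach G E v = direct_reach G D v"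
      using sumE by (simp add: split)
    then show ?case
      using D' step by (metis converse_rtranclp_into_rtranclp)
  qed
qed

lemma t_solvable_complete_iff:
  assumes K: "K\<^bsub>n\<^esub> G"
  shows "t_solvable G t D \<longleftrightarrow> (\<forall>v\<in>verts G. t \<le> direct_reach G D v)"
proof
  assume "t_solvable G t D"
  then show "\<forall>v\<in>verts G. t \<le> direct_reach G D v"
    unfolding t_solvable_def
    using direct_reach_moves_le[OF K] direct_reach_ge[OF complete_digraph_finite_verts[OF K]]
    by (meson le_trans)
next
  assume "\<forall>v\<in>verts G. t \<le> direct_reach G D v"
  then show "t_solvable G t D"
    unfolding t_solvable_def using direct_reach_attained[OF K] by (meson le_trans)
qed

text \<open>\<open>D v\<close> is the floor plus the ceiling of its half. Only the ceiling still
  depends on \<open>v\<close>, which prepares the summation over \<open>v\<close>.\<close>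

lemma direct_reach_eq:
  assumes "finite (verts G)" and "v \<in> verts G"
  shows "direct_reach G D v = (\<Sum>u\<in>verts G. D u div 2) + (D v + 1) div 2"
proof -
  have "(\<Sum>u\<in>verts G. D u div 2) = D v div 2 + (\<Sum>u\<in>verts G - {v}. D u div 2)"
    using assms by (rule sum.remove)
  then show ?thesis
    unfolding direct_reach_remove[OF assms] by presburger
qed

lemma t_solvable_complete_counts:
  assumes K: "K\<^bsub>n\<^esub> G" and "t_solvable G t D"
  obtains S k where "dist_size G D = 2 * S + k" "n * t \<le> (n + 1) * S + k"
proof
  define S where "S = (\<Sum>u\<in>verts G. D u div 2)"
  define k where "k = (\<Sum>u\<in>verts G. D u mod 2)"
  show "dist_size G D = 2 * S + k"
    unfolding dist_size_def S_def k_def sum_distrib_left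
    by (simp flip: sum.distrib)
  have "n * t = (\<Sum>v\<in>verts G. t)"
    by (simp add: complete_digraph_card_verts[OF K])
  also have "\<dots> \<le> (\<Sum>v\<in>verts G. S + (D v + 1) div 2)"
    using assms(2) direct_reach_eq[OF complete_digraph_finite_verts[OF K]]
    by (intro sum_mono) (simp add: t_solvable_complete_iff[OF K] S_def)
  \<comment> \<open>The ceiling of a half is its floor plus the parity; the floors add one more
    \<open>S\<close>, the parities add \<open>k\<close>.\<close>
  also have "\<dots> = (\<Sum>v\<in>verts G. S + (D v div 2 + D v mod 2))"
    by (intro sum.cong refl) presburger
  also have "\<dots> = (n + 1) * S + k"
    by (simp add: sum.distrib S_def k_def complete_digraph_card_verts[OF K])
  finally show "n * t \<le> (n + 1) * S + k" .
qed

text \<open>At \<open>S = n * q + r\<close> the constraint has slack \<open>r\<close>. Lowering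
  \<open>S\<close> by one saves two pebbles but costs \<open>n + 1\<close> in the constraint, which
  \<open>k\<close> must make up. The first drop thus needs \<open>k\<close> at least
  \<open>n + 1 - r\<close>, which is below 2 only for \<open>r = n\<close>: hence the exceptional
  case.\<close>

lemma pebbles_lower_bound:
  fixes n q r S k :: nat
  assumes "n > 0" and "r \<le> n" and "n * ((n + 1) * q + r) \<le> (n + 1) * S + k"
  shows "2 * n * q + 2 * r - (if r = n then 1 else 0) \<le> 2 * S + k"
proof (cases "n * q + r \<le> S")
  case True
  then show ?thesis by (auto simp: algebra_simps)
next
  case False
  \<comment> \<open>\<open>j + 1\<close> is the shortfall of \<open>S\<close>.\<close>
  then obtain j where j: "n * q + r = S + 1 + j"
    by (metis add.commute less_imp_Suc_add not_le plus_1_eq_Suc add.assoc add_Suc_right)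
  have "(n + 1) * (n * q + r) = n * ((n + 1) * q + r) + r"
    by (simp add: algebra_simps)
  then have "(n + 1) * (S + 1 + j) \<le> (n + 1) * S + k + r"
    using assms(3) by (simp add: j)
  then have "n * j + n + j + 1 \<le> k + r"
    by (simp add: algebra_simps)
  moreover have "j \<le> n * j"
    using assms(1) by simp
  ultimately have "n + 1 + 2 * j \<le> k + r"
    by linarith
  then show ?thesis
    using j assms(2) by (auto simp: algebra_simps)
qed

lemma optimal_pebbling_number_complete:
  fixes n q r :: nat
  assumes K: "K\<^bsub>n\<^esub> G" and n: "n > 0" and r: "r \<le> n"
  shows "optimal_pebbling_number G ((n + 1) * q + r) =
    2 * n * q + 2 * r - (if r = n then 1 else 0)"
proof -
  note fin = complete_digraph_finite_verts[OF K] and card = complete_digraph_card_verts[OF K]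
  obtain a where a: "a \<in> verts G"
    using n card by fastforce
  have two_values: "(\<Sum>v\<in>verts G. if v = a then x else y) = x + (n - 1) * y" for x y :: nat
    using fin a card by (simp add: sum.remove[of _ a])
  have upper: "\<exists>D. t_solvable G ((n + 1) * q + r) D \<and>
      dist_size G D = 2 * n * q + 2 * r - (if r = n then 1 else 0)"
  proof (cases "r = n")
    case False
    \<comment> \<open>All values are even, so the halves sum to \<open>n * q + r\<close>; the
      ceiling at any vertex supplies the remaining \<open>q\<close>.\<close>
    define D where "D v = (if v = a then 2 * q + 2 * r else 2 * q)" for v
    have half: "(\<Sum>v\<in>verts G. D v div 2) = n * q + r"
    proof -
      have "(\<Sum>v\<in>verts G. D v div 2) = (\<Sum>v\<in>verts G. if v = a then q + r else q)"
        by (intro sum.cong) (auto simp: D_def)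
      then show ?thesis
        using n by (cases n) (simp_all add: two_values)
    qed
    have "dist_size G D = 2 * n * q + 2 * r"
      using n by (cases n) (simp_all add: dist_size_def D_def two_values algebra_simps)
    moreover have "t_solvable G ((n + 1) * q + r) D"
      unfolding t_solvable_complete_iff[OF K]
      by (simp add: direct_reach_eq[OF fin] half) (simp add: D_def)
    ultimately show ?thesis
      using False by auto
  next
    case True
    \<comment> \<open>At \<open>a\<close> one pebble is spared, yet the ceiling there is still
      \<open>q + 1\<close>. The halves lose only one, and \<open>n * q + n - 1 + (q + 1)\<close> is
      exactly the target.\<close>
    define D where "D v = (if v = a then 2 * q + 1 else 2 * q + 2)" for v
    have half: "(\<Sum>v\<in>verts G. D v div 2) + 1 = n * q + n"
    proof -
      have "(\<Sum>v\<in>verts G. D v div 2) = (\<Sum>v\<in>verts G. if v = a then q else q + 1)"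
        by (intro sum.cong) (auto simp: D_def)
      then show ?thesis
        using n by (cases n) (simp_all add: two_values)
    qed
    have "dist_size G D = 2 * n * q + 2 * n - 1"
      using n by (cases n) (simp_all add: dist_size_def D_def two_values algebra_simps)
    moreover have "t_solvable G ((n + 1) * q + n) D"
      unfolding t_solvable_complete_iff[OF K]
    proof
      fix v assume v: "v \<in> verts G"
      have "(D v + 1) div 2 = q + 1"
        by (simp add: D_def)
      then show "(n + 1) * q + n \<le> direct_reach G D v"
        using half by (simp add: direct_reach_eq[OF fin v])
    qed
    ultimately show ?thesis
      using True by auto
  qed
  have lower: "2 * n * q + 2 * r - (if r = n then 1 else 0) \<le> dist_size G D"
    if sol: "t_solvable G ((n + 1) * q + r) D" for D
    using t_solvable_complete_counts[OF K sol] pebbles_lower_bound[OF n r] by metis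
  show ?thesis
    unfolding optimal_pebbling_number_def using upper lower by (intro Least_equality) blast+
qed

theorem theorem3p3:
  fixes n t q r :: nat and G :: "('a, 'b) pre_digraph"
  assumes "n > 0" and "t > 0"
    and "K\<^bsub>n\<^esub> G"
    and "t = (n + 1) * q + r" and "int q = \<lfloor>real t / real (n + 1)\<rfloor>" and "r \<le> n"
  shows "(r < n \<longrightarrow>
            int (optimal_pebbling_number G t) = 2 * int t - 2 * int q \<and>
            2 * int t - 2 * int q = 2 * int n * int q + 2 * int r) \<and>
         (r = n \<longrightarrow>
            int (optimal_pebbling_number G t) = 2 * int t - 2 * int q - 1 \<and>
            2 * int t - 2 * int q - 1 = 2 * int n * int q + 2 * int n - 1) \<and>
         (optimal_pebbling_number G t = 2 * t \<longleftrightarrow> t < n)"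
proof -
  have opt: "optimal_pebbling_number G t = 2 * n * q + 2 * r - (if r = n then 1 else 0)"
    using optimal_pebbling_number_complete[OF assms(3) assms(1) assms(6)] assms(4) by simp
  have t: "t = n * q + q + r"
    using assms(4) by simp
  \<comment> \<open>The saving over \<open>2 * t\<close> is \<open>2 * q\<close>, plus 1 if
    \<open>r = n\<close>; it vanishes just when \<open>q = 0\<close> and
    \<open>r < n\<close>.\<close>
  have "optimal_pebbling_number G t = 2 * t \<longleftrightarrow> t < n"
  proof
    assume "optimal_pebbling_number G t = 2 * t"
    then have "2 * q + (if r = n then 1 else 0) = 0"
      using opt assms(1) by (auto simp: t split: if_splits)
    then show "t < n"
      using assms(6) t by (auto split: if_splits)
  next
    assume "t < n"
    have "q = 0"
    proof (rule ccontr)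
      assume "q \<noteq> 0"
      then have "n \<le> n * q"
        by simp
      then show False
        using \<open>t < n\<close> t by linarith
    qed
    then show "optimal_pebbling_number G t = 2 * t"
      using opt t \<open>t < n\<close> by simp
  qed
  then show ?thesis
    using opt assms(1) by (auto simp: t of_nat_diff)
qed

end
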